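(* Let $\|\cdot\|$ be a phs-functional on $\mathbb R^2$, let $p,q\in\mathbb R$ with $q\ne0$, and assume that $Q(z)\ge\frac{p^2}{4q}$ for all $z\in\mathbb R^2\setminus\{\mathfrak o\}$. Let $z=(x,y)^T\in\mathbb R^2$ be a solution of the vector equation $$z\circ z+p\,z+q\,\mathbf 1=\mathfrak o ,$$ written in usual polar coordinates as $x=r\cos\varphi$, $y=r\sin\varphi$ with $r\ge0$, $\varphi\in[0,2\pi)$, and suppose $\varphi\notin\{0,\pi\}$. Then $$\frac{N^2(\varphi)\cos^2\varphi}{N(2\varphi)}=\frac{p^2}{4q}\qquad\text{and}\qquad r=\frac{\sqrt{q\,N(2\varphi)}}{N(\varphi)} .$$
   Context: Vectors in $\mathbb R^2$ are columns; addition and multiplication by real scalars are the usual componentwise operations. Notation: $\mathbf 1=(1,0)^T$, $\mathfrak o=(0,0)^T$. A phs-functional is a positively homogeneous functional $\|\cdot\|:\mathbb R^2\to[0,\infty)$ (i.e. $\|\lambda z\|=\lambda\|z\|$ for $\lambda\ge 0$) such that $B=\{z\in\mathbb R^2:\|z\|\le1\}$ is star-shaped with respect to the interior point $\mathfrak o$; moreover $\|z\|>0$ for $z\neq\mathfrak o$. The circular product on $\mathbb R^2$ is $(x_1,y_1)^T\circledast(x_2,y_2)^T=(x_1x_2-y_1y_2,\;x_1y_2+x_2y_1)^T$. The vector-valued product with respect to $\|\cdot\|$ is $$z_1\circ z_2=\frac{\|z_1\|\,\|z_2\|}{\|z_1\circledast z_2\|}\,(z_1\circledast z_2),$$ with $z_1\circ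 z_2=\mathfrak o$ if $z_1=\mathfrak o$ or $z_2=\mathfrak o$. For $z\ne\mathfrak o$ put $Q(z)=\dfrac{\|z\|^2}{\|z\circledast z\|}$. For $\varphi\in\mathbb R$ put $N(\varphi)=\|(\cos\varphi,\sin\varphi)^T\|$. *)

theory Defs
  imports "HOL-Analysis.Analysis"
begin

definition unit_ball :: "(real^2 \<Rightarrow> real) \<Rightarrow> (real^2) set" where
  "unit_ball f = {z. f z \<le> 1}"

(* Star-shapedness is relative to the fixed centre 0, unlike the library's starlike,
   which asks only for some centre. *)
definition phs_functional :: "(real^2 \<Rightarrow> real) \<Rightarrow> bool" where
  "phs_functional f \<longleftrightarrow>
     (\<forall>z. f z \<ge> 0) \<and>
     (\<forall>c z. c \<ge> 0 \<longrightarrow> f (c *\<^sub>R z) = c * f z) \<and>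
     0 \<in> interior (unit_ball f) \<and>
     (\<forall>z \<in> unit_ball f. closed_segment 0 z \<subseteq> unit_ball f) \<and>
     (\<forall>z. z \<noteq> 0 \<longrightarrow> f z > 0)"

definition one_vec :: "real^2" where
  "one_vec = vector [1, 0]"

definition circ_prod :: "real^2 \<Rightarrow> real^2 \<Rightarrow> real^2" (infixl "\<circledast>" 70) where
  "z \<circledast> w = vector [z$1 * w$1 - z$2 * w$2, z$1 * w$2 + w$1 * z$2]"

definition vec_prod :: "(real^2 \<Rightarrow> real) \<Rightarrow> real^2 \<Rightarrow> real^2 \<Rightarrow> real^2" where
  "vec_prod f z w =
     (if z = 0 \<or> w = 0 then 0 else (f z * f w / f (z \<circledast> w)) *\<^sub>R (z \<circledast> w))"

definition Q_quot :: "(real^2 \<Rightarrow> real) \<Rightarrow> real^2 \<Rightarrow> real" where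
  "Q_quot f z = (f z)\<^sup>2 / f (z \<circledast> z)"

definition N_polar :: "(real^2 \<Rightarrow> real) \<Rightarrow> real \<Rightarrow> real" where
  "N_polar f t = f (vector [cos t, sin t])"

end

theory Submission
  imports Defs
begin

text \<open>The product \<open>\<circledast>\<close> is complex multiplication, so in polar form
  \<open>vec_prod f z z\<close> has angle \<open>2 * \<phi>\<close> and coefficient
  \<open>k * r\<^sup>2\<close>, where \<open>k\<close> is the quotient of
  \<open>(N_polar f \<phi>)\<^sup>2\<close> by \<open>N_polar f (2 * \<phi>)\<close>
  (\<open>vec_prod_polar\<close>). The vector equation becomes two real ones. Off the real axis the
  second can be divided by \<open>r * sin \<phi>\<close>, which determines \<open>p\<close>; the
  first then yields \<open>q = k * r\<^sup>2\<close>. Both claims follow by algebra, with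
  \<open>N_polar_pos\<close> justifying the divisions and the square root.\<close>

lemma scaled_circle_point:
  "(vector [r * cos t, r * sin t] :: real^2) = r *\<^sub>R vector [cos t, sin t]"
  by (simp add: vec_eq_iff forall_2)

text \<open>Squaring a complex number doubles its angle: these are the double-angle
  formulas.\<close>

lemma circ_prod_polar:
  "vector [r * cos t, r * sin t] \<circledast> vector [r * cos t, r * sin t]
    = r\<^sup>2 *\<^sub>R vector [cos (2 * t), sin (2 * t)]"
  by (simp add: circ_prod_def vec_eq_iff forall_2 cos_double[of t] sin_double[of t]
      power2_eq_square right_diff_distrib)

lemma circle_point_nonzero: "(vector [cos t, sin t] :: real^2) \<noteq> 0"
  using sin_zero_abs_cos_one[of t] by (auto simp: vec_eq_iff forall_2)

lemma N_polar_pos: "phs_functional f \<Longrightarrow> N_polar f t > 0"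
  using circle_point_nonzero by (auto simp: phs_functional_def N_polar_def)

lemma phs_functional_polar:
  "phs_functional f \<Longrightarrow> c \<ge> 0 \<Longrightarrow> f (c *\<^sub>R vector [cos t, sin t]) = c * N_polar f t"
  by (simp add: phs_functional_def N_polar_def)

text \<open>By homogeneity \<open>f z * f z\<close> and \<open>f (z \<circledast> z)\<close> both
  carry the factor \<open>r\<^sup>2\<close>, which cancels in the normalising quotient; the
  remaining \<open>r\<^sup>2\<close> comes from \<open>z \<circledast> z\<close> itself.\<close>

lemma vec_prod_polar:
  fixes r t :: real
  assumes "phs_functional f" "r > 0"
  defines "z \<equiv> vector [r * cos t, r * sin t]"
  shows "vec_prod f z z
    = ((N_polar f t)\<^sup>2 / N_polar f (2 * t) * r\<^sup>2) *\<^sub>R vector [cos (2 * t), sin (2 * t)]"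
proof -
  have "z \<noteq> 0"
    using assms(2) circle_point_nonzero by (simp add: z_def scaled_circle_point)
  moreover have "f z = r * N_polar f t"
    using assms(1,2) by (simp add: z_def scaled_circle_point phs_functional_polar)
  moreover have "z \<circledast> z = r\<^sup>2 *\<^sub>R vector [cos (2 * t), sin (2 * t)]"
    unfolding z_def by (rule circ_prod_polar)
  ultimately show ?thesis
    using assms(1,2) by (simp add: vec_prod_def phs_functional_polar power2_eq_square)
qed

theorem theorem4p2:
  fixes f :: "real^2 \<Rightarrow> real" and p q x y r \<phi> :: real and z :: "real^2"
  assumes "phs_functional f"
    and "q \<noteq> 0"
    and "\<forall>w. w \<noteq> 0 \<longrightarrow> Q_quot f w \<ge> p\<^sup>2 / (4 * q)"
    and "z = vector [x, y]"
    and "vec_prod f z z + p *\<^sub>R z + q *\<^sub>R one_vec = 0"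
    and "x = r * cos \<phi>" and "y = r * sin \<phi>"
    and "r \<ge> 0" and "\<phi> \<in> {0..<2 * pi}"
    and "\<phi> \<notin> {0, pi}"
  shows "(N_polar f \<phi>)\<^sup>2 * (cos \<phi>)\<^sup>2 / N_polar f (2 * \<phi>) = p\<^sup>2 / (4 * q)
    \<and> r = sqrt (q * N_polar f (2 * \<phi>)) / N_polar f \<phi>"
proof -
  \<comment> \<open>\<open>k\<close> is the value of \<open>Q_quot f\<close> at the unit vector of
    angle \<open>\<phi>\<close>.\<close>
  define n m k where "n = N_polar f \<phi>" and "m = N_polar f (2 * \<phi>)" and "k = n\<^sup>2 / m"
  have pos: "n > 0" "m > 0" "k > 0"
    using N_polar_pos[OF assms(1), of \<phi>] N_polar_pos[OF assms(1), of "2 * \<phi>"]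
    by (simp_all add: n_def m_def k_def)
  \<comment> \<open>At the origin the equation would collapse to
    \<open>q *\<^sub>R one_vec = 0\<close>.\<close>
  have "r \<noteq> 0"
  proof
    assume "r = 0"
    then have "z = 0" using assms(4,6,7) by (simp add: vec_eq_iff forall_2)
    then show False
      using assms(2,5) by (simp add: vec_prod_def one_vec_def vec_eq_iff forall_2)
  qed
  then have r: "r > 0" using assms(8) by simp
  have s: "sin \<phi> \<noteq> 0"
  proof (cases "\<phi> < pi")
    case True
    then show ?thesis using assms(9,10) sin_gt_zero[of \<phi>] by auto
  next
    case False
    then show ?thesis using assms(9,10) sin_lt_zero[of \<phi>] by auto
  qed
  have "(k * r\<^sup>2) *\<^sub>R vector [cos (2 * \<phi>), sin (2 * \<phi>)]
      + p *\<^sub>R vector [r * cos \<phi>, r * sin \<phi>] + q *\<^sub>R one_vec = 0"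
    using assms(4-7) vec_prod_polar[OF assms(1) r, of \<phi>] by (simp add: k_def n_def m_def)
  then have e1: "k * r\<^sup>2 * cos (2 * \<phi>) + p * (r * cos \<phi>) + q = 0"
    and e2: "k * r\<^sup>2 * sin (2 * \<phi>) + p * (r * sin \<phi>) = 0"
    by (simp_all add: one_vec_def vec_eq_iff forall_2)
  \<comment> \<open>The double-angle formula for sine exposes the common factor
    \<open>r * sin \<phi>\<close>, which is nonzero.\<close>
  have "r * sin \<phi> * (2 * k * r * cos \<phi> + p) = 0"
    using e2 unfolding sin_double by (simp add: power2_eq_square algebra_simps)
  then have p: "p = - 2 * k * r * cos \<phi>"
    using r s by (simp add: eq_neg_iff_add_eq_0 add.commute)
  \<comment> \<open>With \<open>p\<close> eliminated, the bracket equals 1 by the double-angle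
    formula for cosine.\<close>
  have "q = k * r\<^sup>2 * (2 * (cos \<phi>)\<^sup>2 - cos (2 * \<phi>))"
    using e1 unfolding p by (simp add: power2_eq_square algebra_simps)
  then have q: "q = k * r\<^sup>2"
    by (simp add: cos_double_cos)
  have "p\<^sup>2 / (4 * q) = k * (cos \<phi>)\<^sup>2"
    using r pos by (simp add: p q power2_eq_square field_simps)
  moreover have "sqrt (q * m) = n * r"
  proof -
    \<comment> \<open>Here \<open>k * m = n\<^sup>2\<close>; since \<open>n * r\<close> is positive,
      the square root returns it without an absolute value.\<close>
    have "q * m = (n * r)\<^sup>2"
      using pos by (simp add: q k_def power_mult_distrib)
    then show ?thesis using pos r by simp
  qed
  ultimately show ?thesis
    using pos by (simp add: k_def flip: n_def m_def)
qed

end
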